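(* Let $\mathbf X\in\mathbb R^{n\times d}$, $\mathbf y\in\mathbb R^n$, and let $h_\lambda:\mathbb R^d\to\mathbb R$ be convex. Suppose $0<\varepsilon<\varepsilon_0<1$, where $\varepsilon_0$ is a small positive constant, $0<\delta<1$, and $\mathbf P$ is drawn from an $(\varepsilon,\delta)$ oblivious $\ell^2$-subspace embedding over $\tilde n\times n$ matrices; put $\tilde{\mathbf X}=\mathbf P\mathbf X$. Let $\boldsymbol\beta^*$ be any critical point of $f(\boldsymbol\beta)=\frac12\|\mathbf y-\mathbf X\boldsymbol\beta\|_2^2+h_\lambda(\boldsymbol\beta)$ and $\tilde{\boldsymbol\beta}^*$ any critical point of $\tilde f(\boldsymbol\beta)=\frac12\boldsymbol\beta^\top\tilde{\mathbf X}^\top\tilde{\mathbf X}\boldsymbol\beta-\langle\mathbf y,\mathbf X\boldsymbol\beta\rangle+h_\lambda(\boldsymbol\beta)$. Then with probability at least $1-\delta$, $$\|\tilde{\boldsymbol\beta}^*-\boldsymbol\beta^*\|_{\mathbf X}\le\frac{\varepsilon}{1-\varepsilon}\,\|\boldsymbol\beta^*\|_{\mathbf X}.$$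
   Context: Notation: $\|\mathbf u\|_{\mathbf X}=\|\mathbf X\mathbf u\|_2$. A critical point of a function is a point at which $\mathbf 0$ belongs to its limiting subdifferential; for the functions $f$ and $\tilde f$ here (convex, since $h_\lambda$ is convex) this is the usual convex subdifferential. A distribution $\mathcal P$ over $\tilde n\times n$ matrices (where $\tilde n$ is a function of $n,d,\varepsilon,\delta$) is an $(\varepsilon,\delta)$ oblivious $\ell^2$-subspace embedding if for any fixed $n\times d$ matrix $\mathbf X$, with probability at least $1-\delta$ a matrix $\mathbf P\sim\mathcal P$ satisfies $(1-\varepsilon)\|\mathbf X\boldsymbol\beta\|_2^2\le\|\mathbf P\mathbf X\boldsymbol\beta\|_2^2\le(1+\varepsilon)\|\mathbf X\boldsymbol\beta\|_2^2$ for all $\boldsymbol\beta\in\mathbb R^d$. *)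

theory Defs
  imports "HOL-Probability.Probability"
begin

(* Rockafellar-Wets, for finite-valued f: the regular (Frechet) subdifferential, and the limiting
   (general, Mordukhovich) one obtained from it by f-attentive limits. *)

definition regular_subdifferential :: "('a::euclidean_space \<Rightarrow> real) \<Rightarrow> 'a \<Rightarrow> 'a set" where
  "regular_subdifferential f x =
     {v. 0 \<le> Liminf (at x) (\<lambda>z. ereal ((f z - f x - v \<bullet> (z - x)) / norm (z - x)))}"

definition limiting_subdifferential :: "('a::euclidean_space \<Rightarrow> real) \<Rightarrow> 'a \<Rightarrow> 'a set" where
  "limiting_subdifferential f x =
     {v. \<exists>xs vs. xs \<longlonglongrightarrow> x \<and> (\<lambda>k. f (xs k)) \<longlonglongrightarrow> f x \<and>
           (\<forall>k. vs k \<in> regular_subdifferential f (xs k)) \<and> vs \<longlonglongrightarrow> v}"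

definition critical_point :: "('a::euclidean_space \<Rightarrow> real) \<Rightarrow> 'a \<Rightarrow> bool" where
  "critical_point f x \<longleftrightarrow> 0 \<in> limiting_subdifferential f x"

(* A matrix with n rows and d columns has type real^'d^'n. The number of rows of the sketching
   matrix is CARD('m); d, the number of columns of the embedded matrices, is passed as a type. *)

definition oblivious_subspace_embedding ::
    "'d::finite itself \<Rightarrow> real \<Rightarrow> real \<Rightarrow> (real^'n^'m) measure \<Rightarrow> bool" where
  "oblivious_subspace_embedding _ \<epsilon> \<delta> D \<longleftrightarrow>
     prob_space D \<and> sets D = sets borel \<and>
     (\<forall>X :: real^'d^'n.
        measure D {P \<in> space D. \<forall>\<beta>.
            (1 - \<epsilon>) * (norm (X *v \<beta>))\<^sup>2 \<le> (norm ((P ** X) *v \<beta>))\<^sup>2 \<and>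
            (norm ((P ** X) *v \<beta>))\<^sup>2 \<le> (1 + \<epsilon>) * (norm (X *v \<beta>))\<^sup>2} \<ge> 1 - \<delta>)"

definition mat_norm :: "real^'d^'n \<Rightarrow> real^'d \<Rightarrow> real" where
  "mat_norm X u = norm (X *v u)"

definition objective ::
    "real^'d^'n \<Rightarrow> real^'n \<Rightarrow> (real^'d \<Rightarrow> real) \<Rightarrow> real^'d \<Rightarrow> real" where
  "objective X y h \<beta> = 1/2 * (norm (y - X *v \<beta>))\<^sup>2 + h \<beta>"

definition sketched_objective ::
    "real^'d^'m \<Rightarrow> real^'d^'n \<Rightarrow> real^'n \<Rightarrow> (real^'d \<Rightarrow> real) \<Rightarrow> real^'d \<Rightarrow> real" where
  "sketched_objective Xs X y h \<beta> =
     1/2 * (\<beta> \<bullet> ((transpose Xs ** Xs) *v \<beta>)) - y \<bullet> (X *v \<beta>) + h \<beta>"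

end

theory Submission
  imports Defs
begin

text \<open>
  For convex \<open>h\<close> the critical points of both objectives are their global minimisers, so each satisfies
  a variational inequality. Testing each minimiser against the other and adding, \<open>h\<close> and \<open>y\<close> cancel;
  with \<open>u = \<beta>t - \<beta>s\<close> and \<open>A = P ** X\<close> this leaves
  \<open>\<parallel>A u\<parallel>\<^sup>2 \<le> \<langle>X \<beta>s, X u\<rangle> - \<langle>A \<beta>s, A u\<rangle>\<close>. The embedding property bounds the left-hand side below by
  \<open>(1 - \<epsilon>) \<parallel>X u\<parallel>\<^sup>2\<close> and, by polarisation, the right-hand side above by \<open>\<epsilon> \<parallel>X \<beta>s\<parallel> \<parallel>X u\<parallel>\<close>.

  The bound on \<open>measure D\<close> also needs the event to be measurable. Its complement is the projection to
  \<open>P\<close> of the intersection of a closed set of pairs \<open>(P, \<beta>)\<close> (those with \<open>\<beta>\<close> a minimiser) with an open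
  one; in finite dimension this is a countable union of compact sets, and so is its projection.
\<close>

section \<open>Critical points of convex functions are global minimisers\<close>

text \<open>By convexity, moving from \<open>z\<close> towards \<open>x\<close> along the segment
  never increases the difference quotient. A violation at \<open>z\<close> thus recurs arbitrarily
  close to \<open>x\<close> with a quotient at most a fixed negative number, against the
  \<open>Liminf\<close>.\<close>

lemma regular_subgradient_imp_subgradient:
  fixes g :: "'a::euclidean_space \<Rightarrow> real"
  assumes conv: "convex_on UNIV g" and v: "v \<in> regular_subdifferential g x"
  shows "g x + v \<bullet> (z - x) \<le> g z"
proof (rule ccontr)
  assume neg: "\<not> ?thesis"
  define \<eta> where "\<eta> = g x + v \<bullet> (z - x) - g z"
  have \<eta>: "\<eta> > 0" using neg by (simp add: \<eta>_def)
  \<comment> \<open>\<open>c\<close> is the value at \<open>z\<close> of the quotient inside the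
    \<open>Liminf\<close>.\<close>
  define c where "c = - (\<eta> / norm (z - x))"
  have zx: "z \<noteq> x" using \<eta> by (auto simp: \<eta>_def)
  have "c < 0" using \<eta> zx by (simp add: c_def)
  then have "ereal c < 0" by simp
  moreover have "0 \<le> Liminf (at x) (\<lambda>z. ereal ((g z - g x - v \<bullet> (z - x)) / norm (z - x)))"
    using v by (simp add: regular_subdifferential_def)
  ultimately have "\<forall>\<^sub>F w in at x. ereal c < ereal ((g w - g x - v \<bullet> (w - x)) / norm (w - x))"
    unfolding le_Liminf_iff by blast
  then obtain d where d: "d > 0"
    and quot: "\<And>w. w \<noteq> x \<Longrightarrow> dist w x < d \<Longrightarrow> c < (g w - g x - v \<bullet> (w - x)) / norm (w - x)"
    unfolding eventually_at by auto
  define t where "t = min 1 (d / (2 * norm (z - x)))"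
  have t: "0 < t" "t \<le> 1" using d zx by (auto simp: t_def)
  have "t * norm (z - x) \<le> d / (2 * norm (z - x)) * norm (z - x)"
    by (intro mult_right_mono) (auto simp: t_def)
  also have "\<dots> < d" using d zx by simp
  finally have td: "t * norm (z - x) < d" .
  define w where "w = (1 - t) *\<^sub>R x + t *\<^sub>R z"
  have wx: "w - x = t *\<^sub>R (z - x)" by (simp add: w_def algebra_simps)
  then have nw: "norm (w - x) = t * norm (z - x)" using t by simp
  have "w \<noteq> x" using nw t zx by auto
  moreover have "dist w x < d" using nw td by (simp add: dist_norm)
  ultimately have "c < (g w - g x - v \<bullet> (w - x)) / norm (w - x)" using quot by blast
  also have "\<dots> \<le> (- (t * \<eta>)) / norm (w - x)"
  proof (rule divide_right_mono)
    have "g w \<le> (1 - t) * g x + t * g z"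
      unfolding w_def using convex_onD[OF conv, of t x z] t by simp
    then show "g w - g x - v \<bullet> (w - x) \<le> - (t * \<eta>)"
      unfolding wx \<eta>_def by (simp add: algebra_simps)
  qed simp
  also have "\<dots> = c" unfolding nw c_def using t zx by (simp add: field_simps)
  finally show False by simp
qed

text \<open>The subgradient inequality at \<open>xs k\<close> survives the limit because the values
  \<open>g (xs k)\<close> converge too and \<open>vs\<close> tends to 0. Conversely, at a minimiser
  0 is already a regular subgradient, so constant sequences suffice.\<close>

lemma critical_point_convex_iff:
  fixes g :: "'a::euclidean_space \<Rightarrow> real"
  assumes conv: "convex_on UNIV g"
  shows "critical_point g x \<longleftrightarrow> (\<forall>z. g x \<le> g z)"
proof
  assume "critical_point g x"
  then obtain xs vs where lim: "xs \<longlonglongrightarrow> x" "(\<lambda>k. g (xs k)) \<longlonglongrightarrow> g x" "vs \<longlonglongrightarrow> 0"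
    and vs: "\<And>k. vs k \<in> regular_subdifferential g (xs k)"
    unfolding critical_point_def limiting_subdifferential_def by auto
  show "\<forall>z. g x \<le> g z"
  proof
    fix z
    have "(\<lambda>k. g (xs k) + vs k \<bullet> (z - xs k)) \<longlonglongrightarrow> g x + 0 \<bullet> (z - x)"
      by (intro tendsto_intros lim)
    then have "g x + 0 \<bullet> (z - x) \<le> g z"
      using regular_subgradient_imp_subgradient[OF conv vs]
      by (intro tendsto_upperbound[where F = sequentially]) auto
    then show "g x \<le> g z" by simp
  qed
next
  assume min: "\<forall>z. g x \<le> g z"
  have "0 \<in> regular_subdifferential g x"
    unfolding regular_subdifferential_def by (auto intro!: Liminf_bounded simp: min)
  then show "critical_point g x"
    unfolding critical_point_def limiting_subdifferential_def
    by (intro CollectI exI[of _ "\<lambda>_. x"] exI[of _ "\<lambda>_. 0"]) auto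
qed

section \<open>The quadratic objectives along segments\<close>

lemma sketched_objective_eq:
  fixes A :: "real^'d^'m"
  shows "sketched_objective A X y h \<beta> = 1/2 * (norm (A *v \<beta>))\<^sup>2 - y \<bullet> (X *v \<beta>) + h \<beta>"
proof -
  have "\<beta> \<bullet> ((transpose A ** A) *v \<beta>) = (\<beta> v* transpose A) \<bullet> (A *v \<beta>)"
    by (simp only: dot_lmul_matrix matrix_vector_mul_assoc)
  then show ?thesis
    by (simp add: sketched_objective_def power2_norm_eq_inner)
qed

text \<open>The original objective is the sketched one with \<open>X\<close> as its own sketch, up
  to a constant, so facts proved for an arbitrary \<open>A\<close> serve both problems.\<close>

lemma objective_eq_sketched_objective:
  "objective X y h \<beta> = sketched_objective X X y h \<beta> + 1/2 * (norm y)\<^sup>2"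
  by (simp add: objective_def sketched_objective_eq power2_norm_eq_inner algebra_simps inner_commute)

text \<open>The quadratic part is expanded exactly, while \<open>h\<close> is bounded by its chord.
  The coefficient of \<open>t\<close> is the quantity whose sign at a minimiser is wanted.\<close>

lemma sketched_objective_segment:
  fixes A :: "real^'d^'m" and X :: "real^'d^'n"
  assumes conv: "convex_on UNIV h" and t: "0 \<le> t" "t \<le> 1"
  shows "sketched_objective A X y h (x + t *\<^sub>R (z - x)) \<le> sketched_objective A X y h x
    + t * ((A *v x) \<bullet> (A *v (z - x)) - y \<bullet> (X *v (z - x)) + h z - h x)
    + t\<^sup>2 * (norm (A *v (z - x)))\<^sup>2 / 2"
proof -
  have "h (x + t *\<^sub>R (z - x)) \<le> h x + t * (h z - h x)"
    using convex_onD[OF conv t, of x z] by (simp add: algebra_simps)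
  moreover have "(norm (A *v (x + t *\<^sub>R (z - x))))\<^sup>2 = (norm (A *v x))\<^sup>2
      + 2 * t * ((A *v x) \<bullet> (A *v (z - x))) + t\<^sup>2 * (norm (A *v (z - x)))\<^sup>2"
    unfolding matrix_vector_right_distrib matrix_vector_mult_scaleR power2_norm_eq_inner
    by (simp add: inner_add_left inner_add_right inner_commute power2_eq_square)
  moreover have "y \<bullet> (X *v (x + t *\<^sub>R (z - x))) = y \<bullet> (X *v x) + t * (y \<bullet> (X *v (z - x)))"
    by (simp only: matrix_vector_right_distrib matrix_vector_mult_scaleR
        inner_add_right inner_scaleR_right)
  ultimately show ?thesis
    unfolding sketched_objective_eq by (simp add: algebra_simps)
qed

lemma convex_on_sketched_objective:
  fixes A :: "real^'d^'m" and X :: "real^'d^'n"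
  assumes conv: "convex_on UNIV h"
  shows "convex_on UNIV (sketched_objective A X y h)"
proof
  fix t :: real and a b :: "real^'d"
  assume t: "0 < t" "t < 1"
  define g where "g = sketched_objective A X y h"
  define K where "K = (A *v a) \<bullet> (A *v (b - a)) - y \<bullet> (X *v (b - a)) + h b - h a"
  define N where "N = (norm (A *v (b - a)))\<^sup>2"
  have "t\<^sup>2 * N \<le> t * N"
    using t by (intro mult_right_mono) (auto simp: N_def power2_eq_square)
  \<comment> \<open>At \<open>t = 1\<close> the segment bound is an equality. The chord therefore
    carries \<open>t * N / 2\<close> where the segment bound has \<open>t\<^sup>2 * N / 2\<close>,
    which is no larger.\<close>
  moreover have "g b = g a + K + N / 2"
    unfolding g_def K_def N_def sketched_objective_eq matrix_vector_mult_diff_distrib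
      power2_norm_eq_inner
    by (simp add: inner_diff_left inner_diff_right inner_commute field_simps)
  then have "(1 - t) * g a + t * g b = g a + t * K + t * N / 2"
    by (simp add: field_simps)
  moreover have "g (a + t *\<^sub>R (b - a)) \<le> g a + t * K + t\<^sup>2 * N / 2"
    using sketched_objective_segment[OF conv, of t A X y a b] t
    unfolding g_def K_def N_def by simp
  moreover have "(1 - t) *\<^sub>R a + t *\<^sub>R b = a + t *\<^sub>R (b - a)" by (simp add: algebra_simps)
  ultimately show "sketched_objective A X y h ((1 - t) *\<^sub>R a + t *\<^sub>R b)
      \<le> (1 - t) * sketched_objective A X y h a + t * sketched_objective A X y h b"
    unfolding g_def[symmetric] by simp
qed simp

text \<open>A negative linear coefficient would outweigh the quadratic remainder for small
  \<open>t\<close>, so a short step towards \<open>z\<close> would decrease the objective.\<close>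

lemma minimiser_variational_inequality:
  fixes A :: "real^'d^'m" and X :: "real^'d^'n"
  assumes conv: "convex_on UNIV h"
    and min: "\<And>w. sketched_objective A X y h x \<le> sketched_objective A X y h w"
  shows "0 \<le> (A *v x) \<bullet> (A *v (z - x)) - y \<bullet> (X *v (z - x)) + h z - h x" (is "0 \<le> ?K")
proof (rule ccontr)
  assume neg: "\<not> 0 \<le> ?K"
  define N where "N = (norm (A *v (z - x)))\<^sup>2"
  have N: "N \<ge> 0" by (simp add: N_def)
  \<comment> \<open>The \<open>+ 1\<close> keeps the denominator positive when \<open>N = 0\<close>
    and leaves the surplus \<open>t\<close> in \<open>t * N + t \<le> - ?K\<close>, which
    contradicts \<open>- ?K \<le> t * N / 2\<close>.\<close>
  define t where "t = min 1 (- ?K / (N + 1))"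
  have t: "0 < t" "t \<le> 1" using neg N by (auto simp: t_def)
  have "0 \<le> t * ?K + t\<^sup>2 * N / 2"
    using sketched_objective_segment[OF conv, of t A X y x z] min[of "x + t *\<^sub>R (z - x)"] t
    by (simp add: N_def)
  also have "\<dots> = t * (?K + t * N / 2)" by (simp add: algebra_simps power2_eq_square)
  finally have 1: "0 \<le> ?K + t * N / 2" using t by (simp add: zero_le_mult_iff)
  have "t * (N + 1) \<le> - ?K / (N + 1) * (N + 1)"
    using N by (intro mult_right_mono) (auto simp: t_def)
  then have "t * (N + 1) \<le> - ?K" using N by simp
  then have "t * N + t \<le> - ?K" by (simp add: algebra_simps)
  moreover have "0 \<le> t * N" using t N by simp
  ultimately show False using 1 t by linarith
qed

section \<open>Consequences of the embedding inequalities\<close>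

text \<open>A Cauchy-Schwarz bound for the polar form of \<open>Q\<close>, a quadratic form that
  need not be semidefinite: polarise at \<open>s *\<^sub>R a + b\<close> and
  \<open>s *\<^sub>R a - b\<close>, then apply the parallelogram law.\<close>

lemma embedding_inner_diff_bound:
  fixes A :: "real^'d^'m" and X :: "real^'d^'n"
  assumes emb: "\<And>\<beta>. \<bar>(norm (X *v \<beta>))\<^sup>2 - (norm (A *v \<beta>))\<^sup>2\<bar> \<le> \<epsilon> * (norm (X *v \<beta>))\<^sup>2"
  shows "(X *v a) \<bullet> (X *v b) - (A *v a) \<bullet> (A *v b) \<le> \<epsilon> * norm (X *v a) * norm (X *v b)"
    (is "?B \<le> _")
proof (cases "X *v a = 0 \<or> X *v b = 0")
  case True
  \<comment> \<open>The embedding forces the kernel of \<open>X\<close> into that of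
    \<open>A\<close>, so in this degenerate case both sides vanish.\<close>
  moreover have "A *v \<beta> = 0" if "X *v \<beta> = 0" for \<beta>
    using emb[of \<beta>] that by simp
  ultimately show ?thesis by auto
next
  case False
  define p q where "p = norm (X *v a)" and "q = norm (X *v b)"
  have pq: "p > 0" "q > 0" using False by (auto simp: p_def q_def)
  \<comment> \<open>This scaling gives \<open>s *\<^sub>R (X *v a)\<close> and \<open>X *v b\<close>
    equal length, so the sum of squares produced by the parallelogram law collapses to the product
    \<open>4 * s * p * q\<close>.\<close>
  define s where "s = q / p"
  have s: "s > 0" using pq by (simp add: s_def)
  define Q where "Q \<beta> = (norm (X *v \<beta>))\<^sup>2 - (norm (A *v \<beta>))\<^sup>2" for \<beta>
  have "4 * s * ?B = Q (s *\<^sub>R a + b) - Q (s *\<^sub>R a - b)"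
    unfolding Q_def power2_norm_eq_inner matrix_vector_right_distrib
      matrix_vector_mult_diff_distrib matrix_vector_mult_scaleR
    by (simp add: inner_add_left inner_add_right inner_diff_left inner_diff_right
        inner_commute algebra_simps)
  also have "\<dots> \<le> \<epsilon> * (norm (X *v (s *\<^sub>R a + b)))\<^sup>2 + \<epsilon> * (norm (X *v (s *\<^sub>R a - b)))\<^sup>2"
    using emb[of "s *\<^sub>R a + b"] emb[of "s *\<^sub>R a - b"] unfolding Q_def by linarith
  also have "\<dots> = \<epsilon> * (2 * (s * p)\<^sup>2 + 2 * q\<^sup>2)"
    unfolding p_def q_def power_mult_distrib power2_norm_eq_inner matrix_vector_right_distrib
      matrix_vector_mult_diff_distrib matrix_vector_mult_scaleR
    by (simp add: inner_add_left inner_add_right inner_diff_left inner_diff_right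
        inner_commute algebra_simps power2_eq_square)
  also have "\<dots> = 4 * s * (\<epsilon> * p * q)"
    using pq by (simp add: s_def field_simps power2_eq_square)
  finally show ?thesis using s by (simp add: p_def q_def)
qed

text \<open>The deterministic core: randomness enters only through whether \<open>A\<close>
  satisfies the embedding inequalities.\<close>

lemma sketched_minimiser_error:
  fixes A :: "real^'d^'m" and X :: "real^'d^'n"
  assumes conv: "convex_on UNIV h" and \<epsilon>: "0 \<le> \<epsilon>" "\<epsilon> < 1"
    and emb: "\<And>\<beta>. (1 - \<epsilon>) * (norm (X *v \<beta>))\<^sup>2 \<le> (norm (A *v \<beta>))\<^sup>2 \<and>
      (norm (A *v \<beta>))\<^sup>2 \<le> (1 + \<epsilon>) * (norm (X *v \<beta>))\<^sup>2"
    and mins: "\<And>w. sketched_objective X X y h \<beta>s \<le> sketched_objective X X y h w"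
    and mint: "\<And>w. sketched_objective A X y h \<beta>t \<le> sketched_objective A X y h w"
  shows "mat_norm X (\<beta>t - \<beta>s) \<le> \<epsilon> / (1 - \<epsilon>) * mat_norm X \<beta>s"
proof -
  define u where "u = \<beta>t - \<beta>s"
  have emb': "\<bar>(norm (X *v \<beta>))\<^sup>2 - (norm (A *v \<beta>))\<^sup>2\<bar> \<le> \<epsilon> * (norm (X *v \<beta>))\<^sup>2" for \<beta>
    using emb[of \<beta>] by (simp add: abs_le_iff algebra_simps)
  have 1: "0 \<le> (X *v \<beta>s) \<bullet> (X *v u) - y \<bullet> (X *v u) + h \<beta>t - h \<beta>s"
    unfolding u_def by (rule minimiser_variational_inequality[OF conv mins])
  have "0 \<le> (A *v \<beta>t) \<bullet> (A *v (\<beta>s - \<beta>t)) - y \<bullet> (X *v (\<beta>s - \<beta>t)) + h \<beta>s - h \<beta>t"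
    by (rule minimiser_variational_inequality[OF conv mint])
  then have "0 \<le> - ((A *v \<beta>s) \<bullet> (A *v u)) - (norm (A *v u))\<^sup>2 + y \<bullet> (X *v u) + h \<beta>s - h \<beta>t"
    unfolding u_def matrix_vector_mult_diff_distrib power2_norm_eq_inner
    by (simp add: inner_diff_left inner_diff_right inner_commute)
  with 1 have "(norm (A *v u))\<^sup>2 \<le> (X *v \<beta>s) \<bullet> (X *v u) - (A *v \<beta>s) \<bullet> (A *v u)" by linarith
  also have "\<dots> \<le> \<epsilon> * norm (X *v \<beta>s) * norm (X *v u)"
    by (rule embedding_inner_diff_bound[OF emb'])
  finally have "(1 - \<epsilon>) * (norm (X *v u))\<^sup>2 \<le> \<epsilon> * norm (X *v \<beta>s) * norm (X *v u)"
    using emb[of u] by linarith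
  then have *: "((1 - \<epsilon>) * norm (X *v u)) * norm (X *v u)
      \<le> (\<epsilon> * norm (X *v \<beta>s)) * norm (X *v u)"
    by (simp add: power2_eq_square mult.assoc)
  have "(1 - \<epsilon>) * norm (X *v u) \<le> \<epsilon> * norm (X *v \<beta>s)"
  proof (cases "norm (X *v u) = 0")
    case True
    then show ?thesis using \<epsilon> by (simp only: mult_zero_right) simp
  next
    case False
    then show ?thesis using mult_right_le_imp_le[OF *] by simp
  qed
  then show ?thesis
    using \<epsilon> by (simp add: mat_norm_def u_def field_simps)
qed

section \<open>Measurability of the event and the probability bound\<close>

lemma closed_minimiser_pairs:
  fixes X :: "real^'d^'n"
  assumes cont: "continuous_on UNIV h"
  shows "closed {p :: (real^'n^'m) \<times> (real^'d). \<forall>w.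
    sketched_objective (fst p ** X) X y h (snd p) \<le> sketched_objective (fst p ** X) X y h w}"
proof -
  \<comment> \<open>A general continuous \<open>g\<close> covers both arguments of the objective
    that occur: the variable \<open>snd p\<close> and the fixed competitor \<open>w\<close>.\<close>
  have mv: "continuous_on UNIV (\<lambda>p. fst p *v (X *v g p))"
    if g: "continuous_on UNIV g" for g :: "(real^'n^'m) \<times> (real^'d) \<Rightarrow> real^'d"
    unfolding matrix_vector_mult_def by (intro continuous_intros g)
  have X: "continuous_on UNIV (\<lambda>p. X *v g p)"
    if g: "continuous_on UNIV g" for g :: "(real^'n^'m) \<times> (real^'d) \<Rightarrow> real^'d"
    unfolding matrix_vector_mult_def by (intro continuous_intros g)
  have h: "continuous_on UNIV (\<lambda>p. h (g p))"
    if g: "continuous_on UNIV g" for g :: "(real^'n^'m) \<times> (real^'d) \<Rightarrow> real^'d"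
    using continuous_on_compose2[OF cont g] by simp
  have obj: "continuous_on UNIV (\<lambda>p. sketched_objective (fst p ** X) X y h (g p))"
    if g: "continuous_on UNIV g" for g :: "(real^'n^'m) \<times> (real^'d) \<Rightarrow> real^'d"
    unfolding sketched_objective_eq matrix_vector_mul_assoc[symmetric]
    by (intro continuous_intros mv X h g)
  then show ?thesis
    by (intro closed_Collect_all closed_Collect_le obj continuous_intros)
qed

text \<open>Projections of Borel sets need not be Borel, so the shape matters: an exhaustion of
  \<open>U\<close> by compact sets, cut with \<open>C\<close>, has compact and hence closed
  images.\<close>

lemma borel_fst_closed_inter_open:
  fixes C U :: "('a::euclidean_space \<times> 'b::euclidean_space) set"
  assumes C: "closed C" and U: "open U"
  shows "fst ` (C \<inter> U) \<in> sets borel"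
proof -
  obtain F :: "nat \<Rightarrow> ('a \<times> 'b) set" where F: "\<And>n. compact (F n)" "C \<inter> U = (\<Union>n. F n)"
  proof -
    obtain G :: "nat \<Rightarrow> ('a \<times> 'b) set" where G: "\<And>n. compact (G n)" "U = (\<Union>n. G n)"
      using open_Union_compact_subsets[OF U] by metis
    show thesis
      by (rule that[of "\<lambda>n. C \<inter> G n"]) (auto simp: G C closed_Int_compact)
  qed
  have "closed (fst ` F n)" for n
    by (intro compact_imp_closed compact_continuous_image F continuous_intros)
  then show ?thesis
    unfolding F(2) image_UN by (intro sets.countable_UN) auto
qed

text \<open>\<open>\<beta>t\<close> is quantified inside the event because the sketched problem
  depends on \<open>P\<close>; one event serves every choice of critical point.
  \<open>\<beta>s\<close> does not depend on \<open>P\<close> and is fixed outside.\<close>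

theorem mainTheorem3:
  fixes X :: "real^'d^'n" and y :: "real^'n" and h :: "real^'d \<Rightarrow> real"
    and D :: "(real^'n^'m) measure" and \<epsilon> \<epsilon>\<^sub>0 \<delta> :: real and \<beta>s :: "real^'d"
  assumes "convex_on UNIV h"
    and "0 < \<epsilon>" and "\<epsilon> < \<epsilon>\<^sub>0" and "\<epsilon>\<^sub>0 < 1" and "0 < \<delta>" and "\<delta> < 1"
    and "oblivious_subspace_embedding TYPE('d) \<epsilon> \<delta> D"
    and "critical_point (objective X y h) \<beta>s"
  shows "measure D {P \<in> space D.
           \<forall>\<beta>t. critical_point (sketched_objective (P ** X) X y h) \<beta>t \<longrightarrow>
             mat_norm X (\<beta>t - \<beta>s) \<le> \<epsilon> / (1 - \<epsilon>) * mat_norm X \<beta>s} \<ge> 1 - \<delta>"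
proof -
  note conv = assms(1) and ose = assms(7)
  have \<epsilon>: "0 \<le> \<epsilon>" "\<epsilon> < 1" using assms(2-4) by auto
  interpret prob_space D using ose by (simp add: oblivious_subspace_embedding_def)
  have setsD: "sets D = sets borel" using ose by (simp add: oblivious_subspace_embedding_def)
  then have spaceD: "space D = UNIV" using sets_eq_imp_space_eq by fastforce
  have crit: "critical_point (sketched_objective (P ** X) X y h) \<beta> \<longleftrightarrow>
      (\<forall>w. sketched_objective (P ** X) X y h \<beta> \<le> sketched_objective (P ** X) X y h w)"
    for P :: "real^'n^'m" and \<beta>
    by (rule critical_point_convex_iff[OF convex_on_sketched_objective[OF conv]])
  have "objective X y h = (\<lambda>\<beta>. sketched_objective X X y h \<beta> + 1/2 * (norm y)\<^sup>2)"
    by (simp add: objective_eq_sketched_objective fun_eq_iff)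
  moreover have "convex_on UNIV (\<lambda>\<beta>. sketched_objective X X y h \<beta> + 1/2 * (norm y)\<^sup>2)"
    by (intro convex_on_add convex_on_sketched_objective conv) (simp add: convex_on_const)
  ultimately have mins: "sketched_objective X X y h \<beta>s \<le> sketched_objective X X y h w" for w
    using assms(8) critical_point_convex_iff by fastforce
  define good where "good = {P \<in> space D.
    \<forall>\<beta>t. critical_point (sketched_objective (P ** X) X y h) \<beta>t \<longrightarrow>
      mat_norm X (\<beta>t - \<beta>s) \<le> \<epsilon> / (1 - \<epsilon>) * mat_norm X \<beta>s}"
  define E where "E = {P \<in> space D. \<forall>\<beta>.
    (1 - \<epsilon>) * (norm (X *v \<beta>))\<^sup>2 \<le> (norm ((P ** X) *v \<beta>))\<^sup>2 \<and>
    (norm ((P ** X) *v \<beta>))\<^sup>2 \<le> (1 + \<epsilon>) * (norm (X *v \<beta>))\<^sup>2}"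
  have E: "1 - \<delta> \<le> measure D E"
    using ose unfolding oblivious_subspace_embedding_def E_def by blast
  have sub: "E \<subseteq> good"
    unfolding E_def good_def crit using sketched_minimiser_error[OF conv \<epsilon> _ mins] by blast
  \<comment> \<open>\<open>measure\<close> is 0 by default outside \<open>sets D\<close>, so
    \<open>sub\<close> alone would not transfer the bound from \<open>E\<close>.\<close>
  have "good \<in> sets D"
  proof -
    define C where "C = {p :: (real^'n^'m) \<times> (real^'d). \<forall>w.
      sketched_objective (fst p ** X) X y h (snd p) \<le> sketched_objective (fst p ** X) X y h w}"
    \<comment> \<open>Negating the error bound gives a strict inequality, hence an open set;
      \<open>P\<close> is bad iff some minimiser paired with it lies in \<open>U\<close>.\<close>
    define U where "U = {p :: (real^'n^'m) \<times> (real^'d).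
      \<epsilon> / (1 - \<epsilon>) * mat_norm X \<beta>s < mat_norm X (snd p - \<beta>s)}"
    have "closed C"
      unfolding C_def using conv by (intro closed_minimiser_pairs convex_on_continuous) auto
    moreover have "open U"
      unfolding U_def mat_norm_def matrix_vector_mult_def
      by (intro open_Collect_less continuous_intros)
    ultimately have "fst ` (C \<inter> U) \<in> sets borel" by (rule borel_fst_closed_inter_open)
    moreover have "good = - fst ` (C \<inter> U)"
      proof (rule set_eqI)
      fix P
      have "P \<in> good \<longleftrightarrow> (\<forall>\<beta>t. (P, \<beta>t) \<in> C \<longrightarrow> (P, \<beta>t) \<notin> U)"
        by (simp add: good_def crit spaceD C_def U_def not_less)
      also have "\<dots> \<longleftrightarrow> P \<in> - fst ` (C \<inter> U)" by force
      finally show "P \<in> good \<longleftrightarrow> P \<in> - fst ` (C \<inter> U)" .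
    qed
    ultimately show ?thesis unfolding setsD by (simp add: borel_comp)
  qed
  then show ?thesis
    using finite_measure_mono[OF sub] E unfolding good_def by linarith
qed

end
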